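(* Let $p\in\mathbb R\setminus\{0\}$. The flow of the vector field $V_p$ on $S_p=S^1_\theta\times M$ is conjugated to the $p$-standard flow $F_p^t$ by a diffeomorphism of $S^1_\theta\times M$ that preserves the $\theta$-coordinate and is isotopic to the identity in the class of diffeomorphisms preserving the $\theta$-coordinate.
   Context: $G$ is the 3D Heisenberg group of real unipotent upper triangular matrices $\begin{pmatrix}1&a&c\\0&1&b\\0&0&1\end{pmatrix}$, with coordinates $(a,b,c)$ and product $(a,b,c)\cdot(\bar a,\bar b,\bar c)=(a+\bar a,\,b+\bar b,\,c+\bar c+a\bar b)$. $H\subset G$ is the discrete subgroup of elements with $a,b,c\in\mathbb Z$, $M=H\backslash G=\{Hg\mid g\in G\}$ is the compact Heisenberg nil-manifold. The left-invariant fields $X_1=\partial_a$, $X_2=\partial_b+a\,\partial_c$, $X_3=[X_1,X_2]=\partial_c$ on $G$ project to fields $X_1',X_2',X_3'$ on $M$. On $T^*M$ let $h_i(\lambda)=\langle\lambda,X_i'\rangle$ and let $\mathcal H=(h_1^2+h_2^2)/2$ be the normal sub-Riemannian Hamiltonian; its Hamiltonian vector field is $\dot h_1=-h_2h_3,\ \dot h_2=h_1h_3,\ \dot h_3=0,\ \dot q=h_1X_1'(q)+h_2X_2'(q)$. The invariant level surface $S_p=\{\lambda\in T^*M\mid \mathcal H(\lambda)=1/2,\ h_3(\lambda)=p\}$ is identified with $S^1_\theta\times M$, $S^1_\theta=\mathbb R/2\pi\mathbb Z$, via $h_1=\cos\theta$, $h_2=\sin\theta$. $V_p$ is the restriction of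 the Hamiltonian vector field to $S_p$; it is written (in coordinates $(\theta,a,b,c)$ on the covering $S^1_\theta\times G$) as $$\dot\theta=p,\quad \dot a=\cos\theta,\quad \dot b=\sin\theta,\quad \dot c=a\sin\theta .$$ The $p$-standard flow $F^t_p$ on $S^1_\theta\times M$ is the flow of the vector field written in the same coordinates as $$\dot\theta=p,\quad \dot a=0,\quad \dot b=0,\quad \dot c=\frac1{2p}.$$ *)

theory Defs
  imports "HOL-Analysis.Analysis" "HOL-Algebra.Coset"
begin

section \<open>Smooth maps between Euclidean spaces\<close>

primrec Ck_on ::
  "nat \<Rightarrow> ('a::real_normed_vector \<Rightarrow> 'b::real_normed_vector) \<Rightarrow> 'a set \<Rightarrow> bool" where
  "Ck_on 0 f U \<longleftrightarrow> continuous_on U f"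
| "Ck_on (Suc k) f U \<longleftrightarrow>
     (\<forall>x\<in>U. f differentiable (at x)) \<and>
     (\<forall>v. Ck_on k (\<lambda>x. frechet_derivative f (at x) v) U)"

text \<open>To be used for open \<^term>\<open>U\<close> in a Euclidean space.\<close>

definition smooth_on ::
  "('a::real_normed_vector \<Rightarrow> 'b::real_normed_vector) \<Rightarrow> 'a set \<Rightarrow> bool" where
  "smooth_on f U \<longleftrightarrow> (\<forall>k. Ck_on k f U)"


section \<open>The Heisenberg group and the nil-manifold\<close>

type_synonym heis = "real \<times> real \<times> real"

fun heis_mult :: "heis \<Rightarrow> heis \<Rightarrow> heis" where
  "heis_mult (a, b, c) (a', b', c') = (a + a', b + b', c + c' + a * b')"

definition G :: "heis monoid" where
  "G = \<lparr>carrier = UNIV, mult = heis_mult, one = (0, 0, 0)\<rparr>"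

definition H :: "heis set" where
  "H = {(a, b, c). a \<in> \<int> \<and> b \<in> \<int> \<and> c \<in> \<int>}"

definition M :: "heis set set" where
  "M = rcosets\<^bsub>G\<^esub> H"

fun heis_matrix :: "heis \<Rightarrow> real^3^3" where
  "heis_matrix (a, b, c) =
     vector [vector [1, a, c], vector [0, 1, b], vector [0, 0, 1]]"

lemma inj_heis_matrix: "inj heis_matrix"
  by (auto simp: inj_def vec_eq_iff forall_3)

lemma heis_matrix_mult: "heis_matrix (x \<otimes>\<^bsub>G\<^esub> y) = heis_matrix x ** heis_matrix y"
  by (cases x; cases y)
     (auto simp: G_def vec_eq_iff forall_3 matrix_matrix_mult_def sum_3)

lemma group_G: "group G"
proof (rule groupI)
  fix x assume "x \<in> carrier G"
  obtain a b c where x: "x = (a, b, c)" by (cases x)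
  show "\<exists>y\<in>carrier G. y \<otimes>\<^bsub>G\<^esub> x = \<one>\<^bsub>G\<^esub>"
    by (rule bexI[of _ "(-a, -b, a * b - c)"]) (auto simp: G_def x)
qed (auto simp: G_def algebra_simps)

lemma subgroup_H: "subgroup H G"
proof -
  have "inv\<^bsub>G\<^esub> (a, b, c) = (-a, -b, a * b - c)" for a b c
    by (rule group.inv_equality[OF group_G]) (auto simp: G_def)
  then show ?thesis
    by unfold_locales (auto simp: G_def H_def)
qed


section \<open>The manifold $S^1_\theta \times M$\<close>

definition angle :: "real \<Rightarrow> real set" where
  "angle \<theta> = {\<theta> + 2 * pi * of_int k |k. True}"

definition S1 :: "real set set" where
  "S1 = range angle"

lemma angle_eq_iff: "angle \<theta> = angle \<theta>' \<longleftrightarrow> (\<exists>k::int. \<theta>' = \<theta> + 2 * pi * of_int k)"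
proof
  assume "angle \<theta> = angle \<theta>'"
  moreover have "\<theta>' \<in> angle \<theta>'" by (auto simp: angle_def intro: exI[of _ 0])
  ultimately show "\<exists>k::int. \<theta>' = \<theta> + 2 * pi * of_int k" by (auto simp: angle_def)
next
  assume "\<exists>k::int. \<theta>' = \<theta> + 2 * pi * of_int k"
  then obtain k :: int where k: "\<theta>' = \<theta> + 2 * pi * of_int k" ..
  have "\<theta>' + 2 * pi * of_int j = \<theta> + 2 * pi * of_int (k + j)"
    and "\<theta> + 2 * pi * of_int j = \<theta>' + 2 * pi * of_int (j - k)" for j
    by (auto simp: k algebra_simps)
  then show "angle \<theta> = angle \<theta>'" unfolding angle_def by blast
qed

type_synonym cover = "real \<times> heis"
type_synonym point = "real set \<times> heis set"

definition N :: "point set" where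
  "N = S1 \<times> M"

text \<open>The universal covering of \<^term>\<open>N\<close>, in the coordinates
  $(\theta, a, b, c) \in \mathbb{R} \times G$.\<close>

definition proj :: "cover \<Rightarrow> point" where
  "proj = (\<lambda>(\<theta>, g). (angle \<theta>, H #>\<^bsub>G\<^esub> g))"

lemma range_proj: "range proj = N"
  by (auto simp: proj_def N_def S1_def M_def RCOSETS_def G_def image_iff)

text \<open>The smooth structure on \<^term>\<open>N\<close> is the one that makes the covering \<^term>\<open>proj\<close>
  a local diffeomorphism, so a map from \<^term>\<open>A\<close> into \<^term>\<open>N\<close> is smooth iff it has smooth
  local lifts. If \<^term>\<open>A\<close> is not open, a lift has to extend smoothly to an open
  neighbourhood, as usual for manifolds with boundary.\<close>

definition smooth_into_N :: "'a::euclidean_space set \<Rightarrow> ('a \<Rightarrow> point) \<Rightarrow> bool" where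
  "smooth_into_N A f \<longleftrightarrow>
     (\<forall>x\<in>A. \<exists>U g. open U \<and> x \<in> U \<and> smooth_on g U \<and>
        (\<forall>y\<in>U \<inter> A. f y = proj (g y)))"

text \<open>Functions on \<^term>\<open>N\<close> are HOL functions whose values outside \<^term>\<open>N\<close> are irrelevant.
  A map out of \<^term>\<open>N\<close> is smooth iff its composition with \<^term>\<open>proj\<close> is.\<close>

definition diffeo_N :: "(point \<Rightarrow> point) \<Rightarrow> bool" where
  "diffeo_N \<Phi> \<longleftrightarrow>
     bij_betw \<Phi> N N \<and>
     smooth_into_N UNIV (\<lambda>x. \<Phi> (proj x)) \<and>
     smooth_into_N UNIV (\<lambda>x. inv_into N \<Phi> (proj x))"

definition preserves_theta :: "(point \<Rightarrow> point) \<Rightarrow> bool" where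
  "preserves_theta \<Phi> \<longleftrightarrow> (\<forall>x\<in>N. fst (\<Phi> x) = fst x)"

text \<open>Smooth isotopy to the identity inside the class of diffeomorphisms preserving
  the \<^term>\<open>\<theta>\<close>-coordinate.\<close>

definition theta_isotopic_to_id :: "(point \<Rightarrow> point) \<Rightarrow> bool" where
  "theta_isotopic_to_id \<Phi> \<longleftrightarrow>
     (\<exists>\<Psi> :: real \<Rightarrow> point \<Rightarrow> point.
        (\<forall>s\<in>{0..1}. diffeo_N (\<Psi> s) \<and> preserves_theta (\<Psi> s)) \<and>
        smooth_into_N ({0..1} \<times> UNIV) (\<lambda>(s, x). \<Psi> s (proj x)) \<and>
        (\<forall>x\<in>N. \<Psi> 0 x = x) \<and>
        (\<forall>x\<in>N. \<Psi> 1 x = \<Phi> x))"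


section \<open>Vector fields and flows\<close>

text \<open>A vector field on \<^term>\<open>N\<close> is given by its lift to the covering.\<close>

definition integral_curve :: "(cover \<Rightarrow> cover) \<Rightarrow> (real \<Rightarrow> point) \<Rightarrow> bool" where
  "integral_curve V \<gamma> \<longleftrightarrow>
     (\<forall>t. \<exists>U g. open U \<and> t \<in> U \<and>
        (\<forall>s\<in>U. \<gamma> s = proj (g s) \<and> (g has_vector_derivative V (g s)) (at s)))"

text \<open>The description is proper for the two vector fields below: each of them has exactly
  one integral curve through every point of \<^term>\<open>N\<close>
  (\<open>V_field_well_posed\<close>, \<open>standard_field_well_posed\<close>).\<close>

definition flow :: "(cover \<Rightarrow> cover) \<Rightarrow> real \<Rightarrow> point \<Rightarrow> point" where
  "flow V t q = (THE \<gamma>. integral_curve V \<gamma> \<and> \<gamma> 0 = q) t"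

fun X1 :: "heis \<Rightarrow> heis" where
  "X1 (a, b, c) = (1, 0, 0)"

fun X2 :: "heis \<Rightarrow> heis" where
  "X2 (a, b, c) = (0, 1, a)"

definition V_field :: "real \<Rightarrow> cover \<Rightarrow> cover" where
  "V_field p = (\<lambda>(\<theta>, g). (p, cos \<theta> *\<^sub>R X1 g + sin \<theta> *\<^sub>R X2 g))"

lemma V_field_coordinates:
  "V_field p (\<theta>, a, b, c) = (p, cos \<theta>, sin \<theta>, a * sin \<theta>)"
  by (simp add: V_field_def)

definition standard_field :: "real \<Rightarrow> cover \<Rightarrow> cover" where
  "standard_field p = (\<lambda>(\<theta>, a, b, c). (p, 0, 0, 1 / (2 * p)))"

text \<open>\<open>V_field p\<close> is the restriction of the sub-Riemannian Hamiltonian vector field to the level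
  surface, where \<open>T\<^sup>*G\<close> is trivialized by $(h_1, h_2, h_3)$.\<close>

fun hamiltonian_field :: "(real \<times> real \<times> real) \<times> heis \<Rightarrow> (real \<times> real \<times> real) \<times> heis" where
  "hamiltonian_field ((h1, h2, h3), q) = ((- (h2 * h3), h1 * h3, 0), h1 *\<^sub>R X1 q + h2 *\<^sub>R X2 q)"

definition level_surface :: "real \<Rightarrow> ((real \<times> real \<times> real) \<times> heis) set" where
  "level_surface p = {((h1, h2, h3), q). (h1\<^sup>2 + h2\<^sup>2) / 2 = 1 / 2 \<and> h3 = p}"

fun level_param :: "real \<Rightarrow> cover \<Rightarrow> (real \<times> real \<times> real) \<times> heis" where
  "level_param p (\<theta>, q) = ((cos \<theta>, sin \<theta>, p), q)"

lemma range_level_param: "range (level_param p) = level_surface p"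
proof (intro equalityI subsetI)
  fix y assume "y \<in> range (level_param p)"
  then obtain \<theta> q where "y = ((cos \<theta>, sin \<theta>, p), q)" by auto
  then show "y \<in> level_surface p"
    by (simp only: level_surface_def mem_Collect_eq prod.case sin_cos_squared_add2)
next
  fix y assume y: "y \<in> level_surface p"
  obtain h1 h2 h3 q where y': "y = ((h1, h2, h3), q)" by (metis prod.collapse)
  have h: "h1\<^sup>2 + h2\<^sup>2 = 1" "h3 = p"
    using y unfolding y' level_surface_def by auto
  obtain \<theta> where "h1 = cos \<theta>" "h2 = sin \<theta>"
    using sincos_total_2pi[OF h(1)] by metis
  then have "y = level_param p (\<theta>, q)" by (simp add: y' h)
  then show "y \<in> range (level_param p)" by blast
qed

lemma level_param_eq_iff:
  "level_param p (\<theta>, q) = level_param p (\<theta>', q') \<longleftrightarrow> angle \<theta> = angle \<theta>' \<and> q = q'"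
proof -
  have "angle \<theta> = angle \<theta>' \<longleftrightarrow> sin \<theta>' = sin \<theta> \<and> cos \<theta>' = cos \<theta>"
    by (simp only: angle_eq_iff sin_cos_eq_iff)
  then show ?thesis by auto
qed

lemma hamiltonian_field_level_param:
  assumes "(g has_vector_derivative V_field p (g t)) (at t)"
  shows "((\<lambda>s. level_param p (g s)) has_vector_derivative
           hamiltonian_field (level_param p (g t))) (at t)"
proof -
  define \<theta> q where "\<theta> s = fst (g s)" and "q s = snd (g s)" for s
  then have g: "g = (\<lambda>s. (\<theta> s, q s))" by simp
  have 1: "(\<theta> has_vector_derivative p) (at t)"
    and 2: "(q has_vector_derivative cos (\<theta> t) *\<^sub>R X1 (q t) + sin (\<theta> t) *\<^sub>R X2 (q t)) (at t)"
    using assms bounded_linear.has_vector_derivative[OF bounded_linear_fst assms]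
      bounded_linear.has_vector_derivative[OF bounded_linear_snd assms]
    by (simp_all add: g V_field_def)
  have "(\<theta> has_real_derivative p) (at t)"
    using 1 by (simp add: has_real_derivative_iff_has_vector_derivative)
  then have "((\<lambda>s. cos (\<theta> s)) has_vector_derivative - (sin (\<theta> t) * p)) (at t)"
    and "((\<lambda>s. sin (\<theta> s)) has_vector_derivative cos (\<theta> t) * p) (at t)"
    unfolding has_real_derivative_iff_has_vector_derivative[symmetric]
    by (auto intro!: derivative_eq_intros)
  then show ?thesis
    using 2 by (auto simp: g intro!: has_vector_derivative_Pair has_vector_derivative_const)
qed


subsection \<open>Well-posedness\<close>

lemma proj_eq_iff:
  "proj (\<theta>, a, b, c) = proj (\<theta>', a', b', c') \<longleftrightarrow>
    (\<exists>k m n l :: int. \<theta>' = \<theta> + 2 * pi * of_int k \<and>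
       a' = a + of_int m \<and> b' = b + of_int n \<and> c' = c + of_int l + of_int m * b)"
proof -
  interpret group G by (rule group_G)
  interpret subgroup H G by (rule subgroup_H)
  have mem: "x \<in> H #>\<^bsub>G\<^esub> (a, b, c) \<longleftrightarrow> (\<exists>m n l :: int.
      x = (a + of_int m, b + of_int n, c + of_int l + of_int m * b))" for x
    by (force simp: r_coset_def H_def G_def algebra_simps elim!: Ints_cases)
  have coset: "H #>\<^bsub>G\<^esub> x = H #>\<^bsub>G\<^esub> y \<longleftrightarrow> y \<in> H #>\<^bsub>G\<^esub> x" for x y
  proof
    assume "H #>\<^bsub>G\<^esub> x = H #>\<^bsub>G\<^esub> y"
    then show "y \<in> H #>\<^bsub>G\<^esub> x"
      using rcos_self[OF _ subgroup_H, of y] by (simp add: G_def)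
  next
    assume "y \<in> H #>\<^bsub>G\<^esub> x"
    then show "H #>\<^bsub>G\<^esub> x = H #>\<^bsub>G\<^esub> y"
      by (intro repr_independence subgroup_H) (auto simp: G_def)
  qed
  show ?thesis
    by (simp add: proj_def angle_eq_iff coset mem)
qed

lemma ex1_integral_curve:
  fixes A B V :: "cover \<Rightarrow> cover" and w :: cover
  assumes BA: "\<And>x. B (A x) = x"
    and A: "\<And>x y. proj x = proj y \<Longrightarrow> proj (A x) = proj (A y)"
    and B: "\<And>x y. proj x = proj y \<Longrightarrow> proj (B x) = proj (B y)"
    and w: "\<And>x y t. proj x = proj y \<Longrightarrow> proj (x + t *\<^sub>R w) = proj (y + t *\<^sub>R w)"
    and dA: "\<And>g s. (g has_vector_derivative V (g s)) (at s) \<Longrightarrow>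
               ((\<lambda>s. A (g s)) has_vector_derivative w) (at s)"
    and dB: "\<And>x s. ((\<lambda>s. B (x + s *\<^sub>R w)) has_vector_derivative V (B (x + s *\<^sub>R w))) (at s)"
    and q: "q \<in> N"
  shows "\<exists>!\<gamma>. integral_curve V \<gamma> \<and> \<gamma> 0 = q"
proof -
  obtain x where x: "q = proj x"
    using q range_proj by blast
  show ?thesis
  proof (rule ex1I)
    show "integral_curve V (\<lambda>s. proj (B (A x + s *\<^sub>R w))) \<and> proj (B (A x + 0 *\<^sub>R w)) = q"
      unfolding integral_curve_def
      by (auto simp: x BA intro!: exI[of _ UNIV] exI[of _ "\<lambda>s. B (A x + s *\<^sub>R w)"] dB)
  next
    fix \<gamma> assume \<gamma>: "integral_curve V \<gamma> \<and> \<gamma> 0 = q"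
    define l where "l t = (SOME y. \<gamma> t = proj y)" for t
    have l: "proj (l t) = \<gamma> t" for t
    proof -
      have "\<exists>y. \<gamma> t = proj y" using \<gamma> unfolding integral_curve_def by blast
      then show ?thesis unfolding l_def by (metis (mono_tags, lifting) someI_ex)
    qed
    define \<delta> where "\<delta> t = proj (A (l t) + (- t) *\<^sub>R w)" for t
    have "\<exists>T. open T \<and> t \<in> T \<and> (\<forall>s\<in>T. \<delta> s = \<delta> t)" for t
    proof -
      obtain U g where U: "open U" "t \<in> U"
        and g: "\<And>s. s \<in> U \<Longrightarrow> \<gamma> s = proj (g s)"
          "\<And>s. s \<in> U \<Longrightarrow> (g has_vector_derivative V (g s)) (at s)"
        using \<gamma> unfolding integral_curve_def by metis
      obtain e where e: "e > 0" "ball t e \<subseteq> U"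
        using U by (meson open_contains_ball)
      define h where "h s = A (g s) + (- s) *\<^sub>R w" for s
      have "(h has_vector_derivative 0) (at s within ball t e)" if "s \<in> ball t e" for s
      proof -
        have "((\<lambda>s. (- s) *\<^sub>R w) has_vector_derivative (- 1) *\<^sub>R w) (at s)"
          by (auto intro!: derivative_eq_intros)
        then have "(h has_vector_derivative w + (- 1) *\<^sub>R w) (at s)"
          unfolding h_def using that e
          by (intro has_vector_derivative_add dA g) auto
        then show ?thesis by (simp add: has_vector_derivative_at_within)
      qed
      then obtain k where k: "\<And>s. s \<in> ball t e \<Longrightarrow> h s = k"
        using has_vector_derivative_zero_constant[OF convex_ball] by metis
      have "\<delta> s = proj (h s)" if "s \<in> U" for s
        unfolding \<delta>_def h_def by (intro w A) (simp add: l g that)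
      then have *: "\<delta> s = proj k" if "s \<in> ball t e" for s
        using that e(2) k[OF that] by (metis subsetD)
      have "\<delta> s = \<delta> t" if "s \<in> ball t e" for s
        using *[OF that] *[of t] e(1) by simp
      moreover have "t \<in> ball t e" using e(1) by simp
      ultimately show ?thesis using open_ball by blast
    qed
    then have loc: "\<forall>\<^sub>F s in at t. \<delta> t = \<delta> s" for t
      unfolding eventually_at_topological by metis
    then have "\<delta> t = \<delta> 0" for t
      by (intro connected_local_const[OF connected_UNIV]) (use loc in simp_all)
    then have "proj (A (l t) + (- t) *\<^sub>R w) = proj (A x)" for t
      using A[of "l 0" x] \<gamma> by (simp add: \<delta>_def l x)
    then have "proj (A (l t)) = proj (A x + t *\<^sub>R w)" for t
      using w[of "A (l t) + (- t) *\<^sub>R w" "A x" t] by simp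
    from B[OF this] show "\<gamma> = (\<lambda>s. proj (B (A x + s *\<^sub>R w)))"
      by (auto simp: BA l)
  qed
qed

lemma V_field_well_posed:
  assumes p: "p \<noteq> 0" and q: "q \<in> N"
  shows "\<exists>!\<gamma>. integral_curve (V_field p) \<gamma> \<and> \<gamma> 0 = q"
proof -
  define A :: "cover \<Rightarrow> cover" where
    "A = (\<lambda>(\<theta>, a, b, c). (\<theta>, a - sin \<theta> / p, b + cos \<theta> / p,
       c + a * cos \<theta> / p - sin \<theta> * cos \<theta> / (2 * p\<^sup>2)))"
  define B :: "cover \<Rightarrow> cover" where
    "B = (\<lambda>(\<theta>, a, b, c). (\<theta>, a + sin \<theta> / p, b - cos \<theta> / p,
       c - (a + sin \<theta> / p) * cos \<theta> / p + sin \<theta> * cos \<theta> / (2 * p\<^sup>2)))"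
  define w :: cover where "w = (p, 0, 0, 1 / (2 * p))"
  have per: "sin (\<theta> + 2 * pi * of_int k) = sin \<theta>" "cos (\<theta> + 2 * pi * of_int k) = cos \<theta>"
    for \<theta> and k :: int
    using sin_cos_eq_iff[of "\<theta> + 2 * pi * of_int k" \<theta>] by (auto simp: mult_ac)
  have sin_sq: "sin x * sin x = 1 - cos x * cos x" for x :: real
    using sin_cos_squared_add3[of x] by linarith
  show ?thesis
  proof (rule ex1_integral_curve[where A = A and B = B and w = w])
    show "B (A x) = x" for x
      by (cases x) (simp add: A_def B_def)
    show "proj (A x) = proj (A y)" if xy: "proj x = proj y" for x y
    proof -
      obtain \<theta> a b c where x: "x = (\<theta>, a, b, c)" by (metis prod.collapse)
      obtain \<theta>' a' b' c' where y: "y = (\<theta>', a', b', c')" by (metis prod.collapse)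
      obtain k m n l :: int where *: "\<theta>' = \<theta> + 2 * pi * of_int k"
        "a' = a + of_int m" "b' = b + of_int n" "c' = c + of_int l + of_int m * b"
        using xy unfolding x y proj_eq_iff by blast
      show ?thesis
        unfolding x y A_def prod.case proj_eq_iff * per
        by (rule exI[of _ k], rule exI[of _ m], rule exI[of _ n], rule exI[of _ l])
          (simp add: algebra_simps add_divide_distrib)
    qed
    show "proj (B x) = proj (B y)" if xy: "proj x = proj y" for x y
    proof -
      obtain \<theta> a b c where x: "x = (\<theta>, a, b, c)" by (metis prod.collapse)
      obtain \<theta>' a' b' c' where y: "y = (\<theta>', a', b', c')" by (metis prod.collapse)
      obtain k m n l :: int where *: "\<theta>' = \<theta> + 2 * pi * of_int k"
        "a' = a + of_int m" "b' = b + of_int n" "c' = c + of_int l + of_int m * b"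
        using xy unfolding x y proj_eq_iff by blast
      show ?thesis
        unfolding x y B_def prod.case proj_eq_iff * per
        by (rule exI[of _ k], rule exI[of _ m], rule exI[of _ n], rule exI[of _ l])
          (simp add: algebra_simps add_divide_distrib)
    qed
    show "proj (x + t *\<^sub>R w) = proj (y + t *\<^sub>R w)" if xy: "proj x = proj y" for x y t
    proof -
      obtain \<theta> a b c where x: "x = (\<theta>, a, b, c)" by (metis prod.collapse)
      obtain \<theta>' a' b' c' where y: "y = (\<theta>', a', b', c')" by (metis prod.collapse)
      show ?thesis
        using xy by (simp add: x y w_def proj_eq_iff algebra_simps)
    qed
    show "((\<lambda>s. A (g s)) has_vector_derivative w) (at s)"
      if "(g has_vector_derivative V_field p (g s)) (at s)" for g s
    proof -
      define \<theta> a b c where "\<theta> s = fst (g s)" and "a s = fst (snd (g s))"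
        and "b s = fst (snd (snd (g s)))" and "c s = snd (snd (snd (g s)))" for s
      then have g: "g = (\<lambda>s. (\<theta> s, a s, b s, c s))" by simp
      have 0: "((\<lambda>s. (\<theta> s, a s, b s, c s)) has_vector_derivative
          (p, cos (\<theta> s), sin (\<theta> s), a s * sin (\<theta> s))) (at s)"
        using that by (simp add: g V_field_coordinates)
      note 1 = bounded_linear.has_vector_derivative[OF bounded_linear_snd 0, simplified]
      note 2 = bounded_linear.has_vector_derivative[OF bounded_linear_snd 1, simplified]
      have [derivative_intros]:
        "(\<theta> has_real_derivative p) (at s)"
        "(a has_real_derivative cos (\<theta> s)) (at s)"
        "(b has_real_derivative sin (\<theta> s)) (at s)"
        "(c has_real_derivative a s * sin (\<theta> s)) (at s)"
        using bounded_linear.has_vector_derivative[OF bounded_linear_fst 0]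
          bounded_linear.has_vector_derivative[OF bounded_linear_fst 1]
          bounded_linear.has_vector_derivative[OF bounded_linear_fst 2]
          bounded_linear.has_vector_derivative[OF bounded_linear_snd 2]
        by (simp_all add: has_real_derivative_iff_has_vector_derivative)
      have "((\<lambda>s. a s - sin (\<theta> s) / p) has_real_derivative 0) (at s)"
        "((\<lambda>s. b s + cos (\<theta> s) / p) has_real_derivative 0) (at s)"
        using p by (auto intro!: derivative_eq_intros)
      moreover have "((\<lambda>s. c s + a s * cos (\<theta> s) / p - sin (\<theta> s) * cos (\<theta> s) / (2 * p\<^sup>2))
        has_real_derivative 1 / (2 * p)) (at s)"
        apply (rule derivative_eq_intros refl | simp add: p)+
        using p by (simp add: field_simps power2_eq_square power4_eq_xxxx sin_sq)
      ultimately show ?thesis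
        using \<open>(\<theta> has_real_derivative p) (at s)\<close>
        unfolding has_real_derivative_iff_has_vector_derivative g A_def w_def prod.case
        by (intro has_vector_derivative_Pair)
    qed
    show "((\<lambda>s. B (x + s *\<^sub>R w)) has_vector_derivative V_field p (B (x + s *\<^sub>R w))) (at s)" for x s
    proof -
      obtain \<theta> a b c where x: "x = (\<theta>, a, b, c)" by (metis prod.collapse)
      have "((\<lambda>s. \<theta> + s * p) has_real_derivative p) (at s)"
        "((\<lambda>s. a + sin (\<theta> + s * p) / p) has_real_derivative cos (\<theta> + s * p)) (at s)"
        "((\<lambda>s. b - cos (\<theta> + s * p) / p) has_real_derivative sin (\<theta> + s * p)) (at s)"
        using p by (auto intro!: derivative_eq_intros)
      moreover have "((\<lambda>s. c + s * (1 / (2 * p)) - (a + sin (\<theta> + s * p) / p) * cos (\<theta> + s * p) / p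
          + sin (\<theta> + s * p) * cos (\<theta> + s * p) / (2 * p\<^sup>2))
        has_real_derivative (a + sin (\<theta> + s * p) / p) * sin (\<theta> + s * p)) (at s)"
        apply (rule derivative_eq_intros refl | simp add: p)+
        using p by (simp add: field_simps power2_eq_square power4_eq_xxxx sin_sq)
      ultimately show ?thesis
        unfolding has_real_derivative_iff_has_vector_derivative
        by (auto simp: x B_def w_def V_field_coordinates intro!: has_vector_derivative_Pair)
    qed
  qed (rule q)
qed

lemma standard_field_well_posed:
  assumes q: "q \<in> N"
  shows "\<exists>!\<gamma>. integral_curve (standard_field p) \<gamma> \<and> \<gamma> 0 = q"
proof -
  define w :: cover where "w = (p, 0, 0, 1 / (2 * p))"
  have V: "standard_field p x = w" for x
    by (cases x) (simp add: standard_field_def w_def)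
  show ?thesis
  proof (rule ex1_integral_curve[where A = "\<lambda>x. x" and B = "\<lambda>x. x" and w = w])
    show "proj (x + t *\<^sub>R w) = proj (y + t *\<^sub>R w)" if xy: "proj x = proj y" for x y t
    proof -
      obtain \<theta> a b c where x: "x = (\<theta>, a, b, c)" by (metis prod.collapse)
      obtain \<theta>' a' b' c' where y: "y = (\<theta>', a', b', c')" by (metis prod.collapse)
      show ?thesis
        using xy by (simp add: x y w_def proj_eq_iff algebra_simps)
    qed
    show "((\<lambda>s. x + s *\<^sub>R w) has_vector_derivative standard_field p (x + s *\<^sub>R w)) (at s)" for x s
      by (auto simp: V intro!: derivative_eq_intros)
  qed (auto simp: V q)
qed

end

theory Submission
  imports Defs
begin

text \<open>
  Along an integral curve of \<^term>\<open>V_field p\<close> the angle grows with speed \<open>p\<close>, so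
  \<open>(a, b)\<close> runs on a circle of radius \<open>1 / \<bar>p\<bar>\<close> and \<open>a - sin \<theta> / p\<close>, \<open>b + cos \<theta> / p\<close> are
  constant. Passing to the centre of that circle is a right translation in the Heisenberg group:
  the point \<open>(\<theta>, g)\<close> goes to \<open>(\<theta>, g \<cdot> exp (r \<xi>(\<theta>)))\<close>, where \<open>\<xi>(\<theta>) = - sin \<theta> X\<^sub>1 + cos \<theta> X\<^sub>2\<close>
  and \<open>r = 1 / p\<close>. The third coordinate of the translated point grows with the constant speed
  \<open>1 / (2 p)\<close>, so the map straightens \<^term>\<open>V_field p\<close> to
  \<^term>\<open>standard_field p\<close> (\<open>twist_straightens\<close>).

  Because \<open>H\<close> acts from the left and \<open>\<xi>\<close> is periodic, the map descends to \<^term>\<open>N\<close> for each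
  real \<open>r\<close> (\<open>proj_twist_cong\<close>). Because \<open>r \<mapsto> exp (r \<xi>(\<theta>))\<close> is a one-parameter subgroup, these
  maps form a one-parameter group (\<open>twist_twist\<close>): the inverse of the map with parameter \<open>r\<close> is
  the one with parameter \<open>- r\<close>, so all of them are diffeomorphisms, and \<open>r = s / p\<close> with \<open>s\<close>
  running from 0 to 1 is the isotopy from the identity. Conjugacy of the flows follows from
  the straightening, since both fields have unique integral curves.
\<close>

section \<open>Smoothness of trigonometric polynomials\<close>

text \<open>A class of differentiable functions that is closed under directional derivatives can be
  differentiated forever, so its members are smooth.\<close>

lemma smooth_on_UNIV_coinduct:
  fixes f :: "'a::real_normed_vector \<Rightarrow> 'b::real_normed_vector"
  assumes "P f"
    and step: "\<And>f. P f \<Longrightarrow>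
      \<exists>D. (\<forall>x. (f has_derivative D x) (at x)) \<and> (\<forall>v. P (\<lambda>x. D x v))"
  shows "smooth_on f UNIV"
  unfolding smooth_on_def
proof
  show "Ck_on k f UNIV" for k
    using \<open>P f\<close>
  proof (induction k arbitrary: f)
    case 0
    then obtain D where "\<And>x. (f has_derivative D x) (at x)"
      using step by blast
    then show ?case
      by (auto intro: has_derivative_continuous continuous_at_imp_continuous_on)
  next
    case (Suc k)
    obtain D where D: "\<And>x. (f has_derivative D x) (at x)" "\<And>v. P (\<lambda>x. D x v)"
      using step[OF Suc.prems] by blast
    have "frechet_derivative f (at x) = D x" for x
      using frechet_derivative_at[OF D(1)] by simp
    with D Suc.IH show ?case
      by (auto simp: differentiable_def)
  qed
qed

lemma smooth_on_has_derivative: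
  assumes "smooth_on f UNIV"
  shows "(f has_derivative frechet_derivative f (at x)) (at x)"
proof -
  have "Ck_on (Suc 0) f UNIV"
    using assms unfolding smooth_on_def by blast
  then show ?thesis
    by (simp add: frechet_derivative_works)
qed

lemma smooth_on_frechet_derivative:
  assumes "smooth_on f UNIV"
  shows "smooth_on (\<lambda>x. frechet_derivative f (at x) v) UNIV"
  unfolding smooth_on_def
proof
  fix k
  have "Ck_on (Suc k) f UNIV"
    using assms unfolding smooth_on_def by blast
  then show "Ck_on k (\<lambda>x. frechet_derivative f (at x) v) UNIV"
    by simp
qed

lemma smooth_on_Pair:
  assumes "smooth_on f UNIV" "smooth_on g UNIV"
  shows "smooth_on (\<lambda>x. (f x, g x)) UNIV"
proof (rule smooth_on_UNIV_coinduct
    [where P = "\<lambda>h. \<exists>f g. h = (\<lambda>x. (f x, g x)) \<and> smooth_on f UNIV \<and> smooth_on g UNIV"])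
  fix h :: "'a \<Rightarrow> 'b \<times> 'c"
  assume "\<exists>f g. h = (\<lambda>x. (f x, g x)) \<and> smooth_on f UNIV \<and> smooth_on g UNIV"
  then obtain f g where h: "h = (\<lambda>x. (f x, g x))"
    and fg: "smooth_on f UNIV" "smooth_on g UNIV"
    by blast
  show "\<exists>D. (\<forall>x. (h has_derivative D x) (at x)) \<and>
      (\<forall>v. \<exists>f g. (\<lambda>x. D x v) = (\<lambda>x. (f x, g x)) \<and> smooth_on f UNIV \<and> smooth_on g UNIV)"
    unfolding h
  proof (intro exI conjI allI)
    show "((\<lambda>x. (f x, g x)) has_derivative
        (\<lambda>v. (frechet_derivative f (at x) v, frechet_derivative g (at x) v))) (at x)" for x
      by (intro has_derivative_Pair smooth_on_has_derivative fg)
  qed (rule refl, (rule smooth_on_frechet_derivative, rule fg)+)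
qed (use assms in blast)

text \<open>The coordinates of the conjugating maps belong to the following algebra. It is closed under
  directional derivatives, so its members are smooth.\<close>

inductive trig_poly :: "('a::real_normed_vector \<Rightarrow> real) \<Rightarrow> bool" where
  const: "trig_poly (\<lambda>x. c)"
| linear: "bounded_linear l \<Longrightarrow> trig_poly l"
| sin: "bounded_linear l \<Longrightarrow> trig_poly (\<lambda>x. sin (l x))"
| cos: "bounded_linear l \<Longrightarrow> trig_poly (\<lambda>x. cos (l x))"
| add: "trig_poly f \<Longrightarrow> trig_poly g \<Longrightarrow> trig_poly (\<lambda>x. f x + g x)"
| mult: "trig_poly f \<Longrightarrow> trig_poly g \<Longrightarrow> trig_poly (\<lambda>x. f x * g x)"

lemma trig_poly_derivative:
  assumes "trig_poly f"
  shows "\<exists>D. (\<forall>x. (f has_derivative D x) (at x)) \<and> (\<forall>v. trig_poly (\<lambda>x. D x v))"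
  using assms
proof induction
  case (const c)
  show ?case
    by (rule exI[of _ "\<lambda>x v. 0"]) (auto intro: trig_poly.const)
next
  case (linear l)
  then show ?case
    by (intro exI[of _ "\<lambda>x. l"]) (auto intro: trig_poly.const bounded_linear_imp_has_derivative)
next
  case (sin l)
  have "((\<lambda>x. sin (l x)) has_derivative (\<lambda>v. cos (l x) * l v)) (at x)" for x
    using has_derivative_sin[OF bounded_linear_imp_has_derivative[OF sin]]
    by (simp add: mult_ac)
  moreover have "trig_poly (\<lambda>x. cos (l x) * l v)" for v
    by (intro trig_poly.mult trig_poly.cos trig_poly.const sin)
  ultimately show ?case
    by (intro exI[of _ "\<lambda>x v. cos (l x) * l v"]) blast
next
  case (cos l)
  have "((\<lambda>x. cos (l x)) has_derivative (\<lambda>v. sin (l x) * - l v)) (at x)" for x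
    using has_derivative_cos[OF bounded_linear_imp_has_derivative[OF cos]]
    by (simp add: mult_ac)
  moreover have "trig_poly (\<lambda>x. sin (l x) * - l v)" for v
    by (intro trig_poly.mult trig_poly.sin trig_poly.const cos)
  ultimately show ?case
    by (intro exI[of _ "\<lambda>x v. sin (l x) * - l v"]) blast
next
  case (add f g)
  then obtain D E where "\<And>x. (f has_derivative D x) (at x)" "\<And>v. trig_poly (\<lambda>x. D x v)"
    "\<And>x. (g has_derivative E x) (at x)" "\<And>v. trig_poly (\<lambda>x. E x v)"
    by blast
  then show ?case
    by (intro exI[of _ "\<lambda>x v. D x v + E x v"])
      (auto intro: trig_poly.add has_derivative_add)
next
  case (mult f g)
  then obtain D E where "\<And>x. (f has_derivative D x) (at x)" "\<And>v. trig_poly (\<lambda>x. D x v)"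
    "\<And>x. (g has_derivative E x) (at x)" "\<And>v. trig_poly (\<lambda>x. E x v)"
    by blast
  moreover from this have "trig_poly (\<lambda>x. f x * E x v + D x v * g x)" for v
    by (intro trig_poly.add trig_poly.mult mult.hyps)
  ultimately show ?case
    by (intro exI[of _ "\<lambda>x v. f x * E x v + D x v * g x"]) (blast intro: has_derivative_mult)
qed

lemma smooth_on_trig_poly: "trig_poly f \<Longrightarrow> smooth_on f UNIV"
  by (rule smooth_on_UNIV_coinduct[where P = trig_poly, OF _ trig_poly_derivative])


section \<open>Right translation by a rotating one-parameter subgroup\<close>

text \<open>In the coordinates of the Heisenberg group, \<open>exp (x X\<^sub>1 + y X\<^sub>2) = (x, y, x y / 2)\<close>; here
  \<open>x = - r sin \<theta>\<close> and \<open>y = r cos \<theta>\<close>.\<close>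

definition twist :: "real \<Rightarrow> cover \<Rightarrow> cover" where
  "twist r = (\<lambda>(\<theta>, g).
     (\<theta>, heis_mult g (- r * sin \<theta>, r * cos \<theta>, (- r * sin \<theta>) * (r * cos \<theta>) / 2)))"

lemma twist_coordinates:
  "twist r (\<theta>, a, b, c) =
    (\<theta>, a - r * sin \<theta>, b + r * cos \<theta>, c + a * (r * cos \<theta>) - r * sin \<theta> * (r * cos \<theta>) / 2)"
  by (simp add: twist_def)

lemma twist_0 [simp]: "twist 0 x = x"
  by (cases x) (simp add: twist_coordinates)

text \<open>For a fixed angle the translating elements form a one-parameter subgroup.\<close>

lemma twist_twist: "twist r (twist s x) = twist (r + s) x"
  by (cases x) (simp add: twist_coordinates algebra_simps add_divide_distrib)

lemma fst_twist [simp]: "fst (twist r x) = fst x"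
  by (simp add: twist_def split_beta)

text \<open>Right translations commute with the left action of \<open>H\<close>, and the translating element is
  \<open>2 \<pi>\<close>-periodic in the angle.\<close>

lemma proj_twist_cong:
  assumes "proj x = proj y"
  shows "proj (twist r x) = proj (twist r y)"
proof -
  obtain \<theta> a b c where x: "x = (\<theta>, a, b, c)" by (metis prod.collapse)
  obtain \<theta>' a' b' c' where y: "y = (\<theta>', a', b', c')" by (metis prod.collapse)
  obtain k m n l :: int where *: "\<theta>' = \<theta> + 2 * pi * of_int k"
    "a' = a + of_int m" "b' = b + of_int n" "c' = c + of_int l + of_int m * b"
    using assms unfolding x y proj_eq_iff by blast
  have "sin \<theta>' = sin \<theta>" "cos \<theta>' = cos \<theta>"
    using sin_cos_eq_iff[of \<theta>' \<theta>] *(1) by blast+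
  then show ?thesis
    unfolding x y twist_coordinates proj_eq_iff
    by (intro exI[of _ k] exI[of _ m] exI[of _ n] exI[of _ l])
      (simp add: * algebra_simps)
qed

text \<open>The parameter and the point may depend on a common variable \<open>z\<close>: this covers both a single
  twist and a family of twists as a map of the parameter and the point.\<close>

lemma smooth_on_twist:
  assumes "trig_poly \<rho>" "bounded_linear \<theta>" "trig_poly a" "trig_poly b" "trig_poly c"
  shows "smooth_on (\<lambda>z. twist (\<rho> z) (\<theta> z, a z, b z, c z)) UNIV"
proof -
  have "smooth_on (\<lambda>z. (\<theta> z, a z + (- 1) * (\<rho> z * sin (\<theta> z)), b z + \<rho> z * cos (\<theta> z),
      c z + a z * (\<rho> z * cos (\<theta> z)) + (- 1 / 2) * (\<rho> z * sin (\<theta> z) * (\<rho> z * cos (\<theta> z))))) UNIV"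
    by (intro smooth_on_Pair smooth_on_trig_poly trig_poly.add trig_poly.mult trig_poly.const
        assms trig_poly.linear[OF assms(2)] trig_poly.sin[OF assms(2)] trig_poly.cos[OF assms(2)])
  then show ?thesis
    by (simp add: twist_coordinates algebra_simps)
qed

text \<open>The value \<open>r = 1 / p\<close> makes the first two coordinates of the image constant; by
  \<open>cos\<^sup>2 \<theta> + sin\<^sup>2 \<theta> = 1\<close> the third one then has constant speed.\<close>

lemma twist_straightens:
  assumes p: "p \<noteq> 0" and g: "(g has_vector_derivative V_field p (g s)) (at s)"
  shows "((\<lambda>s. twist (1 / p) (g s)) has_vector_derivative
    standard_field p (twist (1 / p) (g s))) (at s)"
proof -
  define \<theta> a b c where "\<theta> s = fst (g s)" and "a s = fst (snd (g s))"
    and "b s = fst (snd (snd (g s)))" and "c s = snd (snd (snd (g s)))" for s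
  then have g_eq: "g = (\<lambda>s. (\<theta> s, a s, b s, c s))" by simp
  have 0: "((\<lambda>s. (\<theta> s, a s, b s, c s)) has_vector_derivative
      (p, cos (\<theta> s), sin (\<theta> s), a s * sin (\<theta> s))) (at s)"
    using g by (simp add: g_eq V_field_coordinates)
  note 1 = bounded_linear.has_vector_derivative[OF bounded_linear_snd 0, simplified]
  note 2 = bounded_linear.has_vector_derivative[OF bounded_linear_snd 1, simplified]
  have [derivative_intros]:
    "(\<theta> has_real_derivative p) (at s)"
    "(a has_real_derivative cos (\<theta> s)) (at s)"
    "(b has_real_derivative sin (\<theta> s)) (at s)"
    "(c has_real_derivative a s * sin (\<theta> s)) (at s)"
    using bounded_linear.has_vector_derivative[OF bounded_linear_fst 0]
      bounded_linear.has_vector_derivative[OF bounded_linear_fst 1]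
      bounded_linear.has_vector_derivative[OF bounded_linear_fst 2]
      bounded_linear.has_vector_derivative[OF bounded_linear_snd 2]
    by (simp_all add: has_real_derivative_iff_has_vector_derivative)
  have "((\<lambda>s. a s - 1 / p * sin (\<theta> s)) has_real_derivative 0) (at s)"
    "((\<lambda>s. b s + 1 / p * cos (\<theta> s)) has_real_derivative 0) (at s)"
    using p by (auto intro!: derivative_eq_intros)
  moreover have "((\<lambda>s. c s + a s * (1 / p * cos (\<theta> s))
        - 1 / p * sin (\<theta> s) * (1 / p * cos (\<theta> s)) / 2)
      has_real_derivative 1 / (2 * p)) (at s)"
  proof -
    have sin_sq: "sin x * sin x = 1 - cos x * cos x" for x :: real
      using sin_cos_squared_add3[of x] by linarith
    show ?thesis
      by (rule derivative_eq_intros refl | simp add: p)+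
        (use p in \<open>simp add: field_simps power2_eq_square sin_sq\<close>)
  qed
  ultimately show ?thesis
    using \<open>(\<theta> has_real_derivative p) (at s)\<close>
    unfolding has_real_derivative_iff_has_vector_derivative g_eq twist_coordinates
      standard_field_def prod.case
    by (intro has_vector_derivative_Pair)
qed


section \<open>The induced diffeomorphisms of the quotient\<close>

definition twist_N :: "real \<Rightarrow> point \<Rightarrow> point" where
  "twist_N r q = proj (twist r (SOME x. proj x = q))"

lemma twist_N_proj [simp]: "twist_N r (proj x) = proj (twist r x)"
  unfolding twist_N_def by (rule proj_twist_cong, rule someI) (rule refl)

lemma proj_in_N [simp]: "proj x \<in> N"
  using range_proj by blast

lemma ball_N_iff: "(\<forall>q\<in>N. P q) \<longleftrightarrow> (\<forall>x. P (proj x))"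
  unfolding range_proj[symmetric] by blast

lemma bij_betw_twist_N: "bij_betw (twist_N r) N N"
  by (rule bij_betw_byWitness[of _ "twist_N (- r)"])
    (simp_all add: image_subset_iff ball_N_iff twist_twist)

lemma inv_into_twist_N: "inv_into N (twist_N r) (proj x) = proj (twist (- r) x)"
  by (rule inv_into_f_eq[OF bij_betw_imp_inj_on[OF bij_betw_twist_N]])
    (simp_all add: twist_twist)

lemma smooth_into_N_proj:
  assumes "smooth_on g UNIV" "\<And>x. x \<in> A \<Longrightarrow> f x = proj (g x)"
  shows "smooth_into_N A f"
  unfolding smooth_into_N_def using assms open_UNIV by blast

lemma smooth_into_N_twist: "smooth_into_N UNIV (\<lambda>x. proj (twist r x))"
proof (rule smooth_into_N_proj)
  have l: "bounded_linear (\<lambda>x :: cover. fst x)"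
    "bounded_linear (\<lambda>x :: cover. fst (snd x))"
    "bounded_linear (\<lambda>x :: cover. fst (snd (snd x)))"
    "bounded_linear (\<lambda>x :: cover. snd (snd (snd x)))"
    by (intro bounded_linear_fst_comp bounded_linear_snd_comp bounded_linear_ident)+
  show "smooth_on (\<lambda>x. twist r (fst x, fst (snd x), fst (snd (snd x)), snd (snd (snd x)))) UNIV"
    by (rule smooth_on_twist[OF trig_poly.const l(1) l(2-4)[THEN trig_poly.linear]])
qed (simp only: prod.collapse)

lemma diffeo_twist_N: "diffeo_N (twist_N r)"
  by (simp add: diffeo_N_def bij_betw_twist_N smooth_into_N_twist inv_into_twist_N)

lemma preserves_theta_twist_N: "preserves_theta (twist_N r)"
  by (simp add: preserves_theta_def ball_N_iff) (simp add: proj_def split_beta)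

text \<open>The parameter \<open>s r\<close> with \<open>0 \<le> s \<le> 1\<close> runs along the one-parameter group of twists, from
  the identity to the given map.\<close>

lemma twist_N_isotopic_to_id: "theta_isotopic_to_id (twist_N r)"
  unfolding theta_isotopic_to_id_def
proof (intro exI[of _ "\<lambda>s. twist_N (s * r)"] conjI)
  show "smooth_into_N ({0..1} \<times> UNIV) (\<lambda>(s, x). twist_N (s * r) (proj x))"
  proof (rule smooth_into_N_proj)
    have l: "bounded_linear (\<lambda>z :: real \<times> cover. fst z)"
      "bounded_linear (\<lambda>z :: real \<times> cover. fst (snd z))"
      "bounded_linear (\<lambda>z :: real \<times> cover. fst (snd (snd z)))"
      "bounded_linear (\<lambda>z :: real \<times> cover. fst (snd (snd (snd z))))"
      "bounded_linear (\<lambda>z :: real \<times> cover. snd (snd (snd (snd z))))"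
      by (intro bounded_linear_fst_comp bounded_linear_snd_comp bounded_linear_ident)+
    show "smooth_on (\<lambda>z. twist (fst z * r) (fst (snd z), fst (snd (snd z)),
        fst (snd (snd (snd z))), snd (snd (snd (snd z))))) UNIV"
      by (rule smooth_on_twist[OF trig_poly.mult[OF trig_poly.linear[OF l(1)] trig_poly.const]
          l(2) l(3-5)[THEN trig_poly.linear]])
  qed (simp only: split_beta twist_N_proj prod.collapse)
qed (simp_all add: diffeo_twist_N preserves_theta_twist_N ball_N_iff)


section \<open>Conjugacy of the flows\<close>

lemma flow_eqI:
  assumes "\<exists>!\<gamma>. integral_curve V \<gamma> \<and> \<gamma> 0 = q" "integral_curve V \<gamma>" "\<gamma> 0 = q"
  shows "flow V t q = \<gamma> t"
  using the1_equality[OF assms(1)] assms(2,3) by (simp add: flow_def)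

text \<open>Composing a local lift of the curve with the twist gives a local lift of its image.\<close>

lemma integral_curve_twist_N:
  assumes p: "p \<noteq> 0" and \<gamma>: "integral_curve (V_field p) \<gamma>"
  shows "integral_curve (standard_field p) (\<lambda>t. twist_N (1 / p) (\<gamma> t))"
  unfolding integral_curve_def
proof
  fix t
  obtain U g where "open U" "t \<in> U"
    "\<And>s. s \<in> U \<Longrightarrow> \<gamma> s = proj (g s)"
    "\<And>s. s \<in> U \<Longrightarrow> (g has_vector_derivative V_field p (g s)) (at s)"
    using \<gamma> unfolding integral_curve_def by metis
  then show "\<exists>U g. open U \<and> t \<in> U \<and> (\<forall>s\<in>U. twist_N (1 / p) (\<gamma> s) = proj (g s) \<and>
      (g has_vector_derivative standard_field p (g s)) (at s))"
    by (intro exI[of _ U] exI[of _ "\<lambda>s. twist (1 / p) (g s)"])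
      (auto intro: twist_straightens[OF p])
qed

lemma twist_N_conjugates_flows:
  assumes p: "p \<noteq> 0" and q: "q \<in> N"
  shows "twist_N (1 / p) (flow (V_field p) t q) = flow (standard_field p) t (twist_N (1 / p) q)"
proof -
  obtain \<gamma> where \<gamma>: "integral_curve (V_field p) \<gamma>" "\<gamma> 0 = q"
    using V_field_well_posed[OF p q] by blast
  have "twist_N (1 / p) q \<in> N"
    by (rule bij_betw_apply[OF bij_betw_twist_N q])
  then have "flow (standard_field p) t (twist_N (1 / p) q) = twist_N (1 / p) (\<gamma> t)"
    by (intro flow_eqI[OF standard_field_well_posed])
      (simp_all add: integral_curve_twist_N[OF p \<gamma>(1)] \<gamma>(2))
  then show ?thesis
    by (simp add: flow_eqI[OF V_field_well_posed[OF p q] \<gamma>])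
qed

theorem theorem7p3:
  fixes p :: real
  assumes "p \<noteq> 0"
  shows "\<exists>\<Phi>. diffeo_N \<Phi> \<and> preserves_theta \<Phi> \<and> theta_isotopic_to_id \<Phi> \<and>
    (\<forall>t. \<forall>x\<in>N. \<Phi> (flow (V_field p) t x) = flow (standard_field p) t (\<Phi> x))"
  using diffeo_twist_N preserves_theta_twist_N twist_N_isotopic_to_id
    twist_N_conjugates_flows[OF assms] by blast

end
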